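(* Let $D$ be an $n$-vertex source-free bipartite oriented graph that contains no directed cycle of length $4$. Then $D$ has a quasikernel $Q$ such that \[ |Q|\le \frac{17}{35}\,n . \]
   Context: All digraphs are finite and have no loops and no multiple (parallel) arcs; $V(D)$ and $A(D)$ denote the vertex set and arc set of $D$. An oriented graph is a digraph with no directed $2$-cycle (i.e. there are no two vertices $u,v$ with both $uv$ and $vu$ arcs). A digraph is bipartite if its vertex set can be partitioned into two sets each of which contains no arc. A digraph is source-free if every vertex has at least one in-neighbor. For vertices $u,v$, $\operatorname{dist}_D(u,v)$ is the length of a shortest directed path from $u$ to $v$ ($\infty$ if none exists), and for $S\subseteq V(D)$, $\operatorname{dist}_D(S,v)=\min_{s\in S}\operatorname{dist}_D(s,v)$. A set $S\subseteq V(D)$ is independent if there is no arc between any two vertices of $S$. A quasikernel of $D$ is an independent set $Q\subseteq V(D)$ such that $\operatorname{dist}_D(Q,v)\le 2$ for every $v\in V(D)$. *)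

theory Defs
  imports Complex_Main "Graph_Theory.Arc_Walk" "HOL-Library.Extended_Nat"
begin

locale oriented_graph = digraph +
  assumes no_2cycles: "u \<rightarrow> v \<Longrightarrow> \<not> v \<rightarrow> u"

definition source_free :: "('a, 'b) pre_digraph \<Rightarrow> bool" where
  "source_free D \<longleftrightarrow> (\<forall>v \<in> verts D. \<exists>u \<in> verts D. u \<rightarrow>\<^bsub>D\<^esub> v)"

definition independent_set :: "('a, 'b) pre_digraph \<Rightarrow> 'a set \<Rightarrow> bool" where
  "independent_set D S \<longleftrightarrow> S \<subseteq> verts D \<and> (\<forall>u \<in> S. \<forall>v \<in> S. \<not> u \<rightarrow>\<^bsub>D\<^esub> v)"

(* A side of the bipartition may be empty. *)
definition bipartite_digraph :: "('a, 'b) pre_digraph \<Rightarrow> bool" where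
  "bipartite_digraph D \<longleftrightarrow>
     (\<exists>X Y. X \<union> Y = verts D \<and> X \<inter> Y = {} \<and> independent_set D X \<and> independent_set D Y)"

(* In enat, an infimum over the empty set is \<infinity>; a nonempty infimum is attained, so the
   two infima below are the minima of the usual definitions. *)
definition vertex_dist :: "('a, 'b) pre_digraph \<Rightarrow> 'a \<Rightarrow> 'a \<Rightarrow> enat" where
  "vertex_dist D u v = (INF p \<in> {p. pre_digraph.apath D u p v}. enat (length p))"

definition set_dist :: "('a, 'b) pre_digraph \<Rightarrow> 'a set \<Rightarrow> 'a \<Rightarrow> enat" where
  "set_dist D S v = (INF s \<in> S. vertex_dist D s v)"

definition quasikernel :: "('a, 'b) pre_digraph \<Rightarrow> 'a set \<Rightarrow> bool" where
  "quasikernel D Q \<longleftrightarrow> independent_set D Q \<and> (\<forall>v \<in> verts D. set_dist D Q v \<le> 2)"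

end

theory Submission
  imports Defs
begin

text \<open>
  Let \<open>H\<close> be an inclusion-minimal set of vertices such that every vertex of the digraph has an
  in-neighbour in \<open>H\<close>; source-freeness provides one. Each half of \<open>H\<close> under the bipartition is a
  quasikernel, because two backward steps inside \<open>H\<close> return to the same side. One half
  has at most \<open>card H / 2\<close> vertices, which settles the theorem unless \<open>H\<close> contains more than
  \<open>34/35\<close> of all vertices.

  When \<open>H\<close> is almost everything, the digraph is almost a union of directed cycles. Minimality
  gives every \<open>h \<in> H\<close> an out-neighbour whose only in-neighbour in \<open>H\<close> is \<open>h\<close>; one such vertex
  is fixed for each \<open>h\<close>, and the vertices so obtained are called private.
  Let \<open>f\<close> send each vertex to an in-neighbour in \<open>H\<close>. On private vertices \<open>f\<close> is injective and
  \<open>f v\<close> is the only possible in-neighbour of \<open>v\<close> in \<open>H\<close>; only \<open>n - card H\<close> vertices are not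
  private. Let \<open>W\<close> collect the non-private vertices of \<open>H\<close> together with the \<open>f\<close>-images of the
  vertices outside \<open>H\<close>, at most \<open>2 (n - card H)\<close> vertices in all. The vertices of \<open>H\<close> from which
  iterating \<open>f\<close> never meets \<open>W\<close> are permuted by \<open>f\<close>. The cycles of this permutation have length
  \<open>3\<close> or at least \<open>5\<close>, as there are no directed cycles of length \<open>1\<close>, \<open>2\<close> or \<open>4\<close>, so \<open>3/7\<close> of
  these vertices suffice to cover them (\<open>permutation_spacing\<close>). The other vertices of \<open>H\<close> sit at a
  finite depth above \<open>W\<close>, and those of depth \<open>2\<close> modulo \<open>3\<close>, at most a third, are taken.
  Finally a kernel of the bipartite digraph induced on the part of \<open>W\<close> not yet dominated brings
  every vertex of \<open>W\<close> within distance one (\<open>bipartite_kernel\<close>). That one step to spare covers the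
  vertices of depth \<open>1\<close> and the vertices outside \<open>H\<close>. This yields a quasikernel of size at most
  \<open>3/7 n + 2 (n - card H)\<close> (\<open>sparse_quasikernel\<close>), which is at most
  \<open>17/35 n\<close> exactly when \<open>card H \<ge> 34/35 n\<close>.
\<close>

section \<open>Spaced subsets of cycles and permutations\<close>

text \<open>
  A set works if its cyclic gaps are all \<open>2\<close> or \<open>3\<close>. Gaps of \<open>3\<close> are used as long as possible; the
  residue of \<open>m\<close> modulo \<open>3\<close> forces no gap, two gaps or one gap of \<open>2\<close>. So the size is
  \<open>m / 3\<close> rounded up, and the ratio \<open>3/7\<close> is attained at \<open>m = 7\<close>. For \<open>m = 4\<close> the ratio would
  be \<open>1/2\<close>, which is where the exclusion of directed 4-cycles enters the bound.
\<close>

lemma cyclic_spacing: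
  fixes m :: nat
  assumes "m \<ge> 3" "m \<noteq> 4"
  obtains I where "I \<subseteq> {..<m}" "\<And>i. i \<in> I \<Longrightarrow> Suc i mod m \<notin> I"
    "\<And>i. i < m \<Longrightarrow> i \<in> I \<or> Suc i mod m \<in> I \<or> Suc (Suc i) mod m \<in> I"
    "7 * card I \<le> 3 * m"
proof -
  \<comment> \<open>If \<open>m mod 3 = 1\<close>, the last multiple of \<open>3\<close> is \<open>m - 1\<close>, adjacent to \<open>0\<close>; it moves to \<open>m - 2\<close>.\<close>
  define I where "I = {i. i < m \<and> (i mod 3 = 0 \<and> Suc i \<noteq> m \<or> m mod 3 = 1 \<and> i = m - 2)}"
  have step: "Suc i mod m = (if Suc i = m then 0 else Suc i)" if "i < m" for i
    using that by auto
  have step2: "Suc (Suc i) mod m = (if Suc i = m then 1 else if Suc (Suc i) = m then 0 else Suc (Suc i))"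
    if "i < m" for i
    using that assms by (auto simp: mod_Suc)
  have I0: "0 \<in> I" using assms by (auto simp: I_def)
  have "I \<subseteq> (\<lambda>k. 3 * k) ` {..<(m + 1) div 3} \<union> (if m mod 3 = 1 then {m - 2} else {})"
  proof
    fix i assume "i \<in> I"
    have "i \<in> (\<lambda>k. 3 * k) ` {..<(m + 1) div 3}" if "\<not> (m mod 3 = 1 \<and> i = m - 2)"
    proof -
      from \<open>i \<in> I\<close> that have i: "i < m" "i mod 3 = 0" "Suc i \<noteq> m" by (auto simp: I_def)
      then have "(i + 3) div 3 \<le> (m + 1) div 3" by (intro div_le_mono) simp
      then have "i = 3 * (i div 3)" "i div 3 < (m + 1) div 3" using i(2) by auto
      then show ?thesis by blast
    qed
    then show "i \<in> (\<lambda>k. 3 * k) ` {..<(m + 1) div 3} \<union> (if m mod 3 = 1 then {m - 2} else {})"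
      by auto
  qed
  then have "card I \<le> card ((\<lambda>k. 3 * k) ` {..<(m + 1) div 3} \<union> (if m mod 3 = 1 then {m - 2} else {}))"
    by (intro card_mono) auto
  also have "\<dots> \<le> (m + 1) div 3 + (if m mod 3 = 1 then 1 else 0)"
    using card_image_le[of "{..<(m + 1) div 3}" "\<lambda>k. 3 * k"]
    by (intro order.trans[OF card_Un_le] add_mono) auto
  finally have cI: "7 * card I \<le> 7 * ((m + 1) div 3 + (if m mod 3 = 1 then 1 else 0))" by simp
  show thesis
  proof (rule that)
    show "I \<subseteq> {..<m}" by (auto simp: I_def)
    show "Suc i mod m \<notin> I" if "i \<in> I" for i
    proof -
      have "i < m" using that by (simp add: I_def)
      show ?thesis
      proof (cases "Suc i = m")
        case True
        then have "m mod 3 = 1 \<and> i = m - 2" using that by (simp add: I_def)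
        then show ?thesis using True assms by simp
      next
        case False
        have "Suc i \<notin> I"
        proof
          assume "Suc i \<in> I"
          with that False have "i mod 3 = 0" "m mod 3 = 1" "m = i + 3"
            using assms by (auto simp: I_def mod_Suc)
          then show False by simp
        qed
        then show ?thesis using False step[OF \<open>i < m\<close>] by simp
      qed
    qed
    show "i \<in> I \<or> Suc i mod m \<in> I \<or> Suc (Suc i) mod m \<in> I" if "i < m" for i
    proof -
      have "i \<in> I \<or> Suc i \<in> I \<or> Suc (Suc i) \<in> I" if "Suc (Suc i) < m"
      proof -
        have "i mod 3 < 3" by simp
        then consider "i mod 3 = 0" | "i mod 3 = 1" | "i mod 3 = 2" by linarith
        then show ?thesis
        proof cases
          case 3
          then show ?thesis using that by (auto simp: I_def mod_Suc)
        next
          case 2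
          then have "Suc (Suc i) mod 3 = 0" by (simp add: mod_Suc)
          show ?thesis
          proof (cases "m = i + 3")
            case True
            then have "m mod 3 = 1" using 2 by simp
            then have "Suc i \<in> I" using True by (simp add: I_def)
            then show ?thesis by simp
          next
            case False
            then show ?thesis using that \<open>Suc (Suc i) mod 3 = 0\<close> by (simp add: I_def)
          qed
        qed (use that in \<open>simp add: I_def\<close>)
      qed
      then show ?thesis unfolding step[OF \<open>i < m\<close>] step2[OF \<open>i < m\<close>]
        using I0 \<open>i < m\<close> by auto
    qed
    show "7 * card I \<le> 3 * m"
    proof (cases "m mod 3 = 1")
      case True
      then have "m = 3 * (m div 3) + 1" by (metis mult_div_mod_eq)
      then obtain a where a: "m = 3 * a + 1" by blast
      with assms have "a \<ge> 2" by auto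
      have "3 * ((m + 1) div 3) \<le> m + 1" by simp
      then have "(m + 1) div 3 \<le> a" using a by linarith
      then have "7 * ((m + 1) div 3 + 1) \<le> 7 * (a + 1)" by (intro mult_le_mono add_mono) simp_all
      with cI have "7 * card I \<le> 7 * (a + 1)" unfolding if_P[OF True] by (rule order.trans)
      also have "\<dots> \<le> 3 * m" using a \<open>a \<ge> 2\<close> by simp
      finally show ?thesis .
    next
      case False
      have "3 * ((m + 1) div 3) \<le> m + 1" by simp
      then show ?thesis using cI False assms(1) by (cases "m = 3") simp_all
    qed
  qed
qed

text \<open>
  The map \<open>f\<close> points from a vertex to its chosen in-neighbour, so \<open>v\<close> is covered by \<open>v\<close>, \<open>f v\<close>
  or \<open>f (f v)\<close>. The three inequalities exclude exactly the orbit lengths \<open>1\<close>, \<open>2\<close> and \<open>4\<close>,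
  and the orbits are treated one at a time.
\<close>

lemma permutation_spacing:
  fixes f :: "'a \<Rightarrow> 'a"
  assumes "finite C" "inj_on f C" "f ` C \<subseteq> C"
    and "\<And>v. v \<in> C \<Longrightarrow> f v \<noteq> v" "\<And>v. v \<in> C \<Longrightarrow> f (f v) \<noteq> v"
    and "\<And>v. v \<in> C \<Longrightarrow> (f ^^ 4) v \<noteq> v"
  shows "\<exists>Q\<subseteq>C. (\<forall>v\<in>Q. f v \<notin> Q) \<and> (\<forall>v\<in>C. v \<in> Q \<or> f v \<in> Q \<or> f (f v) \<in> Q)
    \<and> 7 * card Q \<le> 3 * card C"
  using assms
proof (induction C rule: finite_psubset_induct)
  case (psubset C)
  show ?case
  proof (cases "C = {}")
    case True
    then show ?thesis by simp
  next
    case False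
    then obtain v where v: "v \<in> C" by auto
    note inj = psubset.prems(1) and closed = psubset.prems(2)
    have pow: "(f ^^ i) u \<in> C" if "u \<in> C" for i u
      using that closed by (induction i) auto
    have injpow: "inj_on (f ^^ i) C" for i
    proof (induction i)
      case (Suc i)
      then show ?case
        using inj pow by (auto simp: inj_on_def)
    qed (auto simp: inj_on_def)
    have cancel: "(f ^^ (j - i)) v = v" if "(f ^^ i) v = (f ^^ j) v" "i \<le> j" for i j
    proof -
      have "(f ^^ i) ((f ^^ (j - i)) v) = (f ^^ i) v"
        using that by (metis comp_apply funpow_add le_add_diff_inverse)
      then show ?thesis using injpow[of i] pow[OF v] v by (auto dest: inj_onD)
    qed
    have "\<not> inj_on (\<lambda>i. (f ^^ i) v) UNIV"
      using finite_subset[of "range (\<lambda>i. (f ^^ i) v)" C] psubset.hyps pow[OF v]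
      by (auto dest!: finite_imageD)
    then obtain i j where ij: "(f ^^ i) v = (f ^^ j) v" "i \<noteq> j"
      unfolding inj_on_def by auto
    have ex: "\<exists>m>0. (f ^^ m) v = v"
    proof (cases "i < j")
      case True
      then show ?thesis using cancel[of i j] ij by (intro exI[of _ "j - i"]) auto
    next
      case False
      then show ?thesis using cancel[of j i] ij by (intro exI[of _ "i - j"]) auto
    qed
    \<comment> \<open>The length of the orbit of \<open>v\<close>.\<close>
    define m where "m = (LEAST m. m > 0 \<and> (f ^^ m) v = v)"
    have m: "m > 0" "(f ^^ m) v = v"
      using LeastI_ex[OF ex] by (auto simp: m_def)
    have least: "m \<le> k" if "k > 0" "(f ^^ k) v = v" for k
      using that unfolding m_def by (intro Least_le) auto
    have fmod: "(f ^^ (k mod m)) v = (f ^^ k) v" for k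
      using m(2) by (rule funpow_mod_eq)
    have inj_idx: "i = j" if "(f ^^ i) v = (f ^^ j) v" "i < m" "j < m" for i j
      using that
    proof (induction i j rule: linorder_wlog)
      case (le i j)
      then show ?case using cancel[of i j] least[of "j - i"] by fastforce
    qed auto
    have "m \<noteq> 1" using m(2) psubset.prems(3)[OF v] by auto
    moreover have "m \<noteq> 2" using m(2) psubset.prems(4)[OF v] by (auto simp: numeral_2_eq_2)
    ultimately have "m \<ge> 3" "m \<noteq> 4" using m psubset.prems(5)[OF v] by auto
    then obtain I where I: "I \<subseteq> {..<m}" "\<And>i. i \<in> I \<Longrightarrow> Suc i mod m \<notin> I"
        "\<And>i. i < m \<Longrightarrow> i \<in> I \<or> Suc i mod m \<in> I \<or> Suc (Suc i) mod m \<in> I"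
        "7 * card I \<le> 3 * m"
      by (rule cyclic_spacing) blast
    define orb where "orb i = (f ^^ i) v" for i
    define O' where "O' = orb ` {..<m}"
    have inj_orb: "inj_on orb {..<m}" using inj_idx by (auto simp: inj_on_def orb_def)
    have f_orb: "f (orb i) = orb (Suc i mod m)" for i
      by (simp add: orb_def fmod)
    have ff_orb: "f (f (orb i)) = orb (Suc (Suc i) mod m)" for i
      unfolding orb_def fmod by simp
    have orb_O: "orb i \<in> O'" for i
    proof -
      have "orb i = orb (i mod m)" by (simp add: orb_def fmod)
      then show ?thesis unfolding O'_def using m by auto
    qed
    have OC: "O' \<subseteq> C" using pow[OF v] by (auto simp: O'_def orb_def)
    have cardO: "card O' = m" by (simp add: O'_def card_image inj_orb)
    \<comment> \<open>Injectivity keeps \<open>f\<close> from entering the orbit from outside, so the rest of \<open>C\<close> is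
      again invariant and the induction hypothesis applies to it.\<close>
    have preimage: "u \<in> O'" if u: "u \<in> C" "f u \<in> O'" for u
    proof -
      obtain i where "f u = orb i" using u(2) by (auto simp: O'_def)
      also have "orb i = orb (i + m)"
        using fmod[of i] fmod[of "i + m"] by (simp add: orb_def)
      also have "\<dots> = f (orb (i + m - 1))"
        using m(1) by (cases "i + m") (auto simp: orb_def)
      finally have "u = orb (i + m - 1)"
        using inj u(1) OC orb_O by (auto dest: inj_onD)
      then show ?thesis using orb_O by simp
    qed
    have closed': "f ` (C - O') \<subseteq> C - O'" using preimage closed by auto
    have "C - O' \<subset> C" using v OC orb_O by blast
    moreover have "inj_on f (C - O')" using inj by (auto simp: inj_on_def)
    ultimately have "\<exists>Q\<subseteq>C - O'. (\<forall>v\<in>Q. f v \<notin> Q)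
        \<and> (\<forall>v\<in>C - O'. v \<in> Q \<or> f v \<in> Q \<or> f (f v) \<in> Q) \<and> 7 * card Q \<le> 3 * card (C - O')"
      using closed' psubset.prems(3-5) by (intro psubset.IH) auto
    then obtain Q where Q: "Q \<subseteq> C - O'" "\<And>v. v \<in> Q \<Longrightarrow> f v \<notin> Q"
        "\<And>v. v \<in> C - O' \<Longrightarrow> v \<in> Q \<or> f v \<in> Q \<or> f (f v) \<in> Q" "7 * card Q \<le> 3 * card (C - O')"
      by blast
    have orb_I: "orb i \<in> orb ` I \<longleftrightarrow> i \<in> I" if "i < m" for i
      using that I(1) inj_orb by (meson inj_on_image_mem_iff lessThan_iff)
    have IO: "orb ` I \<subseteq> O'" using orb_O by auto
    show ?thesis
    proof (intro exI conjI ballI)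
      show "orb ` I \<union> Q \<subseteq> C" using IO OC Q(1) by auto
      show "f u \<notin> orb ` I \<union> Q" if "u \<in> orb ` I \<union> Q" for u
        using that
      proof
        assume "u \<in> orb ` I"
        then obtain i where i: "i \<in> I" "u = orb i" by auto
        then show ?thesis
          using I(2)[OF i(1)] orb_I[of "Suc i mod m"] orb_O Q(1) m(1) f_orb by auto
      next
        assume "u \<in> Q"
        then show ?thesis using Q(1,2) closed' IO by blast
      qed
      show "u \<in> orb ` I \<union> Q \<or> f u \<in> orb ` I \<union> Q \<or> f (f u) \<in> orb ` I \<union> Q" if "u \<in> C" for u
      proof (cases "u \<in> O'")
        case True
        then obtain i where "i < m" "u = orb i" by (auto simp: O'_def)
        then show ?thesis using I(3)[of i] f_orb[of i] ff_orb[of i] by auto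
      next
        case False
        then show ?thesis using Q(3)[of u] that by blast
      qed
      have "card (orb ` I) \<le> card I"
        using I(1) by (intro card_image_le) (auto intro: finite_subset)
      moreover have "card (C - O') = card C - m" "m \<le> card C"
        using OC psubset.hyps cardO by (auto simp: card_Diff_subset finite_subset card_mono)
      moreover have "card (orb ` I \<union> Q) \<le> card (orb ` I) + card Q" by (rule card_Un_le)
      ultimately show "7 * card (orb ` I \<union> Q) \<le> 3 * card C" using I(4) Q(4) by linarith
    qed
  qed
qed

section \<open>Kernels and minimal in-dominating sets\<close>

text \<open>
  A vertex without in-neighbours must belong to a kernel; take it and delete its out-neighbours.
  Once every remaining vertex has an in-neighbour, one side of the bipartition is a kernel.
\<close>

lemma bipartite_kernel:
  assumes "finite W" "\<And>u v. u \<in> W \<Longrightarrow> v \<in> W \<Longrightarrow> E u v \<Longrightarrow> u \<in> X \<longleftrightarrow> v \<notin> X"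
  shows "\<exists>K\<subseteq>W. (\<forall>u\<in>K. \<forall>v\<in>K. \<not> E u v) \<and> (\<forall>v\<in>W. v \<in> K \<or> (\<exists>u\<in>K. E u v))"
  using assms
proof (induction W rule: finite_psubset_induct)
  case (psubset W)
  show ?case
  proof (cases "\<exists>s\<in>W. \<forall>u\<in>W. \<not> E u s")
    case True
    then obtain s where s: "s \<in> W" "\<And>u. u \<in> W \<Longrightarrow> \<not> E u s" by auto
    let ?W = "{v \<in> W. v \<noteq> s \<and> \<not> E s v}"
    have "\<exists>K\<subseteq>?W. (\<forall>u\<in>K. \<forall>v\<in>K. \<not> E u v) \<and> (\<forall>v\<in>?W. v \<in> K \<or> (\<exists>u\<in>K. E u v))"
      using s psubset.prems by (intro psubset.IH) auto
    then obtain K where K: "K \<subseteq> ?W" "\<forall>u\<in>K. \<forall>v\<in>K. \<not> E u v"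
        "\<forall>v\<in>?W. v \<in> K \<or> (\<exists>u\<in>K. E u v)" by (elim exE conjE)
    show ?thesis using K s by (intro exI[of _ "insert s K"]) auto
  next
    case False
    then show ?thesis using psubset.prems by (intro exI[of _ "W \<inter> X"]) blast
  qed
qed

text \<open>
  If \<open>h\<close> had no private out-neighbour, \<open>H - {h}\<close> would still dominate, against minimality.
\<close>

lemma minimal_in_dominating_set:
  assumes "finite V" "\<And>v. v \<in> V \<Longrightarrow> \<exists>u\<in>V. E u v"
  obtains H where "H \<subseteq> V" "\<And>v. v \<in> V \<Longrightarrow> \<exists>u\<in>H. E u v"
    "\<And>h. h \<in> H \<Longrightarrow> \<exists>v\<in>V. E h v \<and> (\<forall>u\<in>H. E u v \<longrightarrow> u = h)"
proof -
  let ?F = "{H. H \<subseteq> V \<and> (\<forall>v\<in>V. \<exists>u\<in>H. E u v)}"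
  have "finite ?F" "V \<in> ?F" using assms by auto
  then obtain H where H: "H \<in> ?F" "\<And>H'. H' \<in> ?F \<Longrightarrow> H' \<subseteq> H \<Longrightarrow> H = H'"
    by (meson finite_has_minimal2)
  show thesis
  proof (rule that[of H])
    show "\<exists>v\<in>V. E h v \<and> (\<forall>u\<in>H. E u v \<longrightarrow> u = h)" if "h \<in> H" for h
    proof -
      have "H - {h} \<notin> ?F" using H(2)[of "H - {h}"] that by auto
      then obtain v where "v \<in> V" "\<forall>u\<in>H - {h}. \<not> E u v" using H(1) by auto
      then show ?thesis using H(1) by blast
    qed
  qed (use H(1) in auto)
qed

section \<open>A quasikernel when almost every vertex is in the dominating set\<close>

text \<open>
  The quasikernel is chosen inside \<open>H\<close>, hence arcs at the vertices outside \<open>H\<close> cannot spoil its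
  independence. Arcs of \<open>H\<close> into a private vertex \<open>v\<close> come from \<open>f v\<close> only, so among private
  vertices independence is a condition on \<open>f\<close> alone. The uncontrolled arcs end in \<open>W\<close>, and there
  the choice is left to a kernel. The term \<open>14 (card V - card H)\<close> is seven times the bound on
  \<open>card W\<close>.
\<close>

lemma sparse_quasikernel:
  fixes f :: "'a \<Rightarrow> 'a"
  assumes fin: "finite V" and HV: "H \<subseteq> V"
    and bip: "\<And>u v. E u v \<Longrightarrow> u \<in> X \<longleftrightarrow> v \<notin> X"
    and asym: "\<And>u v. E u v \<Longrightarrow> \<not> E v u"
    and f: "\<And>v. v \<in> V \<Longrightarrow> f v \<in> H" "\<And>v. v \<in> V \<Longrightarrow> E (f v) v"
    and priv: "\<And>h. h \<in> H \<Longrightarrow> \<exists>v\<in>V. E h v \<and> (\<forall>u\<in>H. E u v \<longrightarrow> u = h)"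
    and C4: "\<And>v. v \<in> V \<Longrightarrow> (f ^^ 4) v \<noteq> v"
  shows "\<exists>Q\<subseteq>V. (\<forall>u\<in>Q. \<forall>v\<in>Q. \<not> E u v)
    \<and> (\<forall>v\<in>V. v \<in> Q \<or> (\<exists>u\<in>Q. E u v) \<or> (\<exists>u\<in>Q. \<exists>w. E u w \<and> E w v))
    \<and> 7 * card Q \<le> 3 * card V + 14 * (card V - card H)"
proof -
  from priv obtain p where p: "\<And>h. h \<in> H \<Longrightarrow> p h \<in> V" "\<And>h. h \<in> H \<Longrightarrow> E h (p h)"
      "\<And>h u. h \<in> H \<Longrightarrow> u \<in> H \<Longrightarrow> E u (p h) \<Longrightarrow> u = h"
    by metis
  have fp: "f (p h) = h" if "h \<in> H" for h
    using p f that by blast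
  define M where "M = V - p ` H"
  have uniq: "u = f v" if "v \<in> V - M" "u \<in> H" "E u v" for u v
    using that p fp by (auto simp: M_def)
  have inj: "inj_on f (V - M)"
    using fp by (auto simp: M_def inj_on_def)
  have injp: "inj_on p H" using fp by (metis inj_on_inverseI)
  have finH: "finite H" using fin HV finite_subset by blast
  have cM: "card M = card V - card H"
    unfolding M_def using p(1) finH by (subst card_Diff_subset) (auto simp: card_image injp)
  \<comment> \<open>The vertices that must end up within distance one: those of \<open>H\<close> with arbitrary
    in-neighbours, and those through which the vertices outside \<open>H\<close> are reached.\<close>
  define W where "W = (M \<inter> H) \<union> f ` (V - H)"
  have WH: "W \<subseteq> H" using f by (auto simp: W_def)
  have finW: "finite W" using WH finH finite_subset by blast
  have cW: "card W \<le> 2 * (card V - card H)"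
  proof -
    have "card W \<le> card (M \<inter> H) + card (f ` (V - H))" unfolding W_def by (rule card_Un_le)
    also have "card (M \<inter> H) \<le> card M" using fin by (intro card_mono) (auto simp: M_def)
    also have "card (f ` (V - H)) \<le> card (V - H)" using fin by (intro card_image_le) auto
    also have "card (V - H) = card V - card H" using HV finH by (simp add: card_Diff_subset)
    finally show ?thesis using cM by simp
  qed
  \<comment> \<open>\<open>d\<close> is the depth above \<open>W\<close>; it is meaningful on \<open>F\<close> only. On the rest \<open>C\<close> of \<open>H\<close> the map
    \<open>f\<close> is a permutation.\<close>
  define F where "F = {v \<in> H. \<exists>i. (f ^^ i) v \<in> W}"
  define d where "d v = (LEAST i. (f ^^ i) v \<in> W)" for v
  define C where "C = H - F"
  have fH: "f v \<in> H" if "v \<in> H" for v using that f HV by auto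
  have WF: "W \<subseteq> F"
  proof
    fix w assume "w \<in> W"
    then show "w \<in> F" using WH unfolding F_def by (auto intro: exI[of _ 0])
  qed
  have dW: "d w = 0" if "w \<in> W" for w
    unfolding d_def using that by (intro Least_eq_0) simp
  have d_step: "f v \<in> F \<and> d v = Suc (d (f v))" if "v \<in> F" "v \<notin> W" for v
  proof -
    obtain i where i: "(f ^^ i) v \<in> W" using \<open>v \<in> F\<close> by (auto simp: F_def)
    with \<open>v \<notin> W\<close> obtain j where "i = Suc j" by (cases i) auto
    with i have "(f ^^ j) (f v) \<in> W" by (simp add: funpow_swap1)
    moreover have "f v \<in> H" using \<open>v \<in> F\<close> fH by (auto simp: F_def)
    moreover have "d v = Suc (LEAST m. (f ^^ Suc m) v \<in> W)"
      unfolding d_def using i \<open>v \<notin> W\<close> by (intro Least_Suc) auto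
    then have "d v = Suc (d (f v))" unfolding d_def by (simp add: funpow_swap1)
    ultimately show ?thesis unfolding F_def by auto
  qed
  have fC: "f v \<in> C" if "v \<in> C" for v
  proof -
    have "(f ^^ Suc i) v \<notin> W" for i using that by (auto simp: C_def F_def simp del: funpow.simps)
    then have "(f ^^ i) (f v) \<notin> W" for i by (simp add: funpow_swap1)
    then show ?thesis using that fH by (auto simp: C_def F_def)
  qed
  have CW: "C \<inter> W = {}" using WF by (auto simp: C_def)
  have nonM: "v \<in> V - M" if "v \<in> H" "v \<notin> W" for v
    using that HV by (auto simp: W_def)
  have CV: "C \<subseteq> V - M" using nonM CW by (auto simp: C_def)
  have "\<exists>Q\<subseteq>C. (\<forall>v\<in>Q. f v \<notin> Q) \<and> (\<forall>v\<in>C. v \<in> Q \<or> f v \<in> Q \<or> f (f v) \<in> Q)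
    \<and> 7 * card Q \<le> 3 * card C"
  proof (rule permutation_spacing)
    show "finite C" using finH by (auto simp: C_def)
    show "inj_on f C" using inj CV by (rule inj_on_subset)
    show "f ` C \<subseteq> C" using fC by auto
    fix v assume "v \<in> C"
    then have v: "v \<in> V" "f v \<in> V" using CV fC by auto
    show "f v \<noteq> v" using f(2)[OF v(1)] bip by metis
    show "f (f v) \<noteq> v" using f(2)[OF v(1)] f(2)[OF v(2)] asym by metis
    show "(f ^^ 4) v \<noteq> v" using C4 v by auto
  qed
  then obtain B where B: "B \<subseteq> C" "\<And>v. v \<in> B \<Longrightarrow> f v \<notin> B"
      "\<And>v. v \<in> C \<Longrightarrow> v \<in> B \<or> f v \<in> B \<or> f (f v) \<in> B" "7 * card B \<le> 3 * card C"
    by blast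
  \<comment> \<open>Depth \<open>1\<close> is skipped, so no arc leads from \<open>W\<close> to \<open>A\<close>, whatever part of \<open>W\<close> is chosen later.\<close>
  define A where "A = {v \<in> F. d v mod 3 = 2}"
  have AW: "A \<inter> W = {}" using dW by (auto simp: A_def)
  have FH: "F \<subseteq> H" by (auto simp: F_def)
  have finF: "finite F" using FH finH finite_subset by blast
  have fA: "f v \<in> F" "d (f v) mod 3 = 1" "f v \<notin> W" "f (f v) \<in> F" "d (f (f v)) mod 3 = 0"
    if "v \<in> A" for v
  proof -
    have "v \<in> F" "v \<notin> W" "d v mod 3 = 2" using that AW by (auto simp: A_def)
    with d_step[of v] show 1: "f v \<in> F" "d (f v) mod 3 = 1"
      by (auto simp: mod_Suc split: if_splits)
    then show 2: "f v \<notin> W" using dW by fastforce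
    with d_step[of "f v"] 1 show "f (f v) \<in> F" "d (f (f v)) mod 3 = 0"
      by (auto simp: mod_Suc split: if_splits)
  qed
  \<comment> \<open>\<open>A\<close>, \<open>f ` A\<close> and \<open>f ` f ` A\<close> have equal size and depths \<open>2\<close>, \<open>1\<close>, \<open>0\<close> modulo \<open>3\<close>.\<close>
  have cA: "3 * card A \<le> card F"
  proof -
    have AM: "A \<subseteq> V - M" using AW FH nonM by (auto simp: A_def)
    have fAM: "f ` A \<subseteq> V - M" using fA FH nonM by blast
    have i1: "inj_on f A" and i2: "inj_on f (f ` A)" using inj AM fAM inj_on_subset by blast+
    have "a \<noteq> f b" "a \<noteq> f (f b)" "f (f b) \<noteq> f a" if "a \<in> A" "b \<in> A" for a b
      using that(1) fA(2)[OF that(1)] fA(2,5)[OF that(2)] by (auto simp: A_def)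
    then have dj: "A \<inter> f ` A = {}" "(A \<union> f ` A) \<inter> f ` f ` A = {}"
      by auto
    have fi: "finite A" using finF by (auto simp: A_def)
    have "card (f ` A) = card A" "card (f ` f ` A) = card A"
      using card_image[OF i1] card_image[OF i2] by simp_all
    then have "3 * card A = card (A \<union> f ` A \<union> f ` f ` A)"
      using card_Un_disjoint[OF _ _ dj(1)] card_Un_disjoint[OF _ _ dj(2)] fi by simp
    also have "\<dots> \<le> card F" using finF fA by (intro card_mono) (auto simp: A_def)
    finally show ?thesis .
  qed
  define W' where "W' = {w \<in> W. \<forall>a\<in>A \<union> B. \<not> E a w}"
  have "\<exists>K\<subseteq>W'. (\<forall>u\<in>K. \<forall>v\<in>K. \<not> E u v) \<and> (\<forall>v\<in>W'. v \<in> K \<or> (\<exists>u\<in>K. E u v))"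
  proof (rule bipartite_kernel)
    show "finite W'" using finW by (simp add: W'_def)
    show "u \<in> X \<longleftrightarrow> v \<notin> X" if "E u v" for u v using that by (rule bip)
  qed
  then obtain K where K: "K \<subseteq> W'" "\<forall>u\<in>K. \<forall>v\<in>K. \<not> E u v"
      "\<forall>v\<in>W'. v \<in> K \<or> (\<exists>u\<in>K. E u v)"
    by (elim exE conjE)
  define Q where "Q = A \<union> B \<union> K"
  have KW: "K \<subseteq> W" using K(1) by (auto simp: W'_def)
  have QH: "Q \<subseteq> H" using FH B(1) KW WH by (auto simp: Q_def A_def C_def)
  have near: "w \<in> Q \<or> (\<exists>u\<in>Q. E u w)" if "w \<in> W" for w
  proof (cases "w \<in> W'")
    case True
    then show ?thesis using K(3) by (auto simp: Q_def)
  next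
    case False
    then show ?thesis using that by (auto simp: Q_def W'_def)
  qed
  have AC: "A \<inter> C = {}" by (auto simp: A_def C_def)
  show ?thesis
  proof (intro exI conjI ballI)
    show "Q \<subseteq> V" using QH HV by auto
    show "\<not> E u v" if uv: "u \<in> Q" "v \<in> Q" for u v
    proof
      assume E: "E u v"
      show False
      proof (cases "v \<in> A \<union> B")
        case True
        then have "v \<in> H" "v \<notin> W" using AW B(1) CW QH by (auto simp: Q_def)
        then have u: "u = f v" using uniq[OF nonM] uv(1) QH E by auto
        show False
        proof (cases "v \<in> A")
          case True
          then have "f v \<notin> A" "f v \<notin> W" "f v \<notin> C" using fA[of v] by (auto simp: A_def C_def)
          then show False using u uv(1) B(1) KW by (auto simp: Q_def)
        next
          case False
          then have "v \<in> B" using True by simp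
          then have "f v \<in> C" "f v \<notin> B" using B(1,2) fC by auto
          then show False using u uv(1) AC CW KW by (auto simp: Q_def)
        qed
      next
        case False
        then have v: "v \<in> K" using uv(2) by (auto simp: Q_def)
        then show False using K(1,2) uv(1) E by (auto simp: Q_def W'_def)
      qed
    qed
    show "v \<in> Q \<or> (\<exists>u\<in>Q. E u v) \<or> (\<exists>u\<in>Q. \<exists>w. E u w \<and> E w v)" if v: "v \<in> V" for v
    proof -
      have arc: "E (f v) v" and fv: "f v \<in> V" using f[OF v] HV by auto
      have arc2: "E (f (f v)) (f v)" using f[OF fv] by auto
      have next_W: ?thesis if "f v \<in> W" using near[OF that] arc by blast
      have next_Q: ?thesis if "f v \<in> Q \<or> f (f v) \<in> Q" using that arc arc2 by blast
      consider "v \<notin> H" | "v \<in> C" | "v \<in> W" | "v \<in> F" "v \<notin> W"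
        using CW by (auto simp: C_def)
      then show ?thesis
      proof cases
        case 1
        then show ?thesis using v by (intro next_W) (auto simp: W_def)
      next
        case 2
        then show ?thesis using B(3)[of v] next_Q by (auto simp: Q_def)
      next
        case 3
        then show ?thesis using near by blast
      next
        case 4
        note s1 = d_step[OF 4]
        show ?thesis
        proof (cases "f v \<in> W")
          case True
          then show ?thesis by (rule next_W)
        next
          case False
          with s1 have s2: "f (f v) \<in> F \<and> d (f v) = Suc (d (f (f v)))" using d_step[of "f v"] by auto
          then have "d v mod 3 = 2 \<or> d (f v) mod 3 = 2 \<or> d (f (f v)) mod 3 = 2"
            using s1 by (simp add: mod_Suc) linarith
          then have "v \<in> A \<or> f v \<in> A \<or> f (f v) \<in> A" using s1 s2 4 by (auto simp: A_def)
          then show ?thesis using next_Q by (auto simp: Q_def)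
        qed
      qed
    qed
    have "card F + card C = card H"
      using FH finF finH by (simp add: C_def card_Diff_subset card_mono)
    moreover have "card H \<le> card V" using HV fin by (rule card_mono[rotated])
    moreover have "card K \<le> card W" using KW finW by (rule card_mono[rotated])
    moreover have "card Q \<le> card A + card B + card K"
      unfolding Q_def by (meson add_le_mono1 card_Un_le order_trans)
    ultimately show "7 * card Q \<le> 3 * card V + 14 * (card V - card H)"
      using cA cW B(4) by linarith
  qed
qed

section \<open>From the arc relation to digraphs\<close>

text \<open>
  Distances are defined through paths with distinct vertices. A walk \<open>u \<rightarrow> w \<rightarrow> v\<close> is such a path,
  since \<open>u = v\<close> would give a directed 2-cycle or put \<open>v\<close> itself into \<open>Q\<close>.
\<close>

lemma (in oriented_graph) quasikernelI:
  assumes "Q \<subseteq> verts G" "\<And>u v. u \<in> Q \<Longrightarrow> v \<in> Q \<Longrightarrow> \<not> u \<rightarrow> v"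
    and two_step: "\<And>v. v \<in> verts G \<Longrightarrow>
      v \<in> Q \<or> (\<exists>u\<in>Q. u \<rightarrow> v) \<or> (\<exists>u\<in>Q. \<exists>w. u \<rightarrow> w \<and> w \<rightarrow> v)"
  shows "quasikernel G Q"
proof -
  have dist: "set_dist G Q v \<le> 2" if "u \<in> Q" "apath u p v" "length p \<le> 2" for u p v
  proof -
    have "vertex_dist G u v \<le> enat (length p)"
      unfolding vertex_dist_def using that(2) by (intro INF_lower) simp
    also have "\<dots> \<le> enat 2" using that(3) by simp
    finally show ?thesis
      unfolding set_dist_def using that(1) by (intro INF_lower2) (auto simp: numeral_eq_enat)
  qed
  have "set_dist G Q v \<le> 2" if v: "v \<in> verts G" for v
  proof -
    consider "v \<in> Q" | u where "u \<in> Q" "u \<rightarrow> v"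
      | u w where "u \<in> Q" "u \<rightarrow> w" "w \<rightarrow> v" "v \<notin> Q"
      using two_step[OF v] by blast
    then show ?thesis
    proof cases
      case 1
      then show ?thesis using v by (intro dist[of v "[]"]) (auto simp: apath_Nil_iff)
    next
      case 2
      then obtain e where "e \<in> arcs G" "tail G e = u" "head G e = v"
        by (auto simp: arcs_ends_conv)
      moreover from this have "u \<noteq> v" using no_loops by auto
      ultimately have "apath u [e] v" by (auto simp: apath_def awalk_def)
      then show ?thesis using 2 by (intro dist) auto
    next
      case 3
      then obtain e e' where "e \<in> arcs G" "tail G e = u" "head G e = w"
          "e' \<in> arcs G" "tail G e' = w" "head G e' = v"
        by (auto simp: arcs_ends_conv)
      moreover from this have "u \<noteq> w" "w \<noteq> v" using no_loops by auto
      moreover have "u \<noteq> v" using 3 by auto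
      ultimately have "apath u [e, e'] v" by (auto simp: apath_def awalk_def)
      then show ?thesis using 3 by (intro dist) auto
    qed
  qed
  then show ?thesis using assms(1,2) by (auto simp: quasikernel_def independent_set_def)
qed

text \<open>
  Equal opposite vertices on the closed walk would create a directed 2-cycle.
\<close>

lemma (in oriented_graph) closed_walk_4_imp_cycle:
  assumes "a \<rightarrow> b" "b \<rightarrow> c" "c \<rightarrow> d" "d \<rightarrow> a"
  shows "\<exists>p. cycle p \<and> length p = 4"
proof -
  obtain e1 e2 e3 e4 where e: "e1 \<in> arcs G" "tail G e1 = a" "head G e1 = b"
      "e2 \<in> arcs G" "tail G e2 = b" "head G e2 = c"
      "e3 \<in> arcs G" "tail G e3 = c" "head G e3 = d"
      "e4 \<in> arcs G" "tail G e4 = d" "head G e4 = a"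
    using assms by (auto simp: arcs_ends_conv)
  have "a \<noteq> b" "b \<noteq> c" "c \<noteq> d" "d \<noteq> a" using assms adj_not_same by blast+
  moreover have "a \<noteq> c" "b \<noteq> d" using assms no_2cycles by auto
  ultimately have "cycle [e1, e2, e3, e4]"
    using e by (auto simp: cycle_def awalk_def intro!: exI[of _ a])
  then show ?thesis by (intro exI[of _ "[e1, e2, e3, e4]"]) simp
qed

section \<open>The bound\<close>

theorem theorem1p6:
  fixes D :: "('a, 'b) pre_digraph" and n :: nat
  assumes "oriented_graph D"
    and "card (verts D) = n"
    and "source_free D"
    and "bipartite_digraph D"
    and "\<not> (\<exists>p. pre_digraph.cycle D p \<and> length p = 4)"
  shows "\<exists>Q. quasikernel D Q \<and> real (card Q) \<le> 17 / 35 * real n"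
proof -
  interpret oriented_graph D by (rule assms(1))
  obtain X Y where XY: "X \<union> Y = verts D" "X \<inter> Y = {}" "independent_set D X" "independent_set D Y"
    using assms(4) by (auto simp: bipartite_digraph_def)
  have bip: "u \<in> X \<longleftrightarrow> v \<notin> X" if "u \<rightarrow>\<^bsub>D\<^esub> v" for u v
  proof -
    have "u \<in> X \<union> Y" "v \<in> X \<union> Y" using that XY(1) by (auto simp: adj_in_verts)
    then show ?thesis using that XY unfolding independent_set_def by blast
  qed
  have "\<And>v. v \<in> verts D \<Longrightarrow> \<exists>u\<in>verts D. u \<rightarrow>\<^bsub>D\<^esub> v"
    using assms(3) by (auto simp: source_free_def)
  then obtain H where HV: "H \<subseteq> verts D"
      and dom: "\<And>v. v \<in> verts D \<Longrightarrow> \<exists>u\<in>H. u \<rightarrow>\<^bsub>D\<^esub> v"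
      and priv: "\<And>h. h \<in> H \<Longrightarrow> \<exists>v\<in>verts D. h \<rightarrow>\<^bsub>D\<^esub> v \<and> (\<forall>u\<in>H. u \<rightarrow>\<^bsub>D\<^esub> v \<longrightarrow> u = h)"
    using minimal_in_dominating_set[of "verts D" "dominates D"] by auto
  have finH: "finite H" using HV finite_verts finite_subset by blast
  have cH: "card H \<le> n" using HV assms(2) card_mono finite_verts by blast
  show ?thesis
  proof (cases "35 * card H \<le> 34 * n")
    case True
    have half: "quasikernel D (H \<inter> Z)" if Z: "\<And>u v. u \<rightarrow>\<^bsub>D\<^esub> v \<Longrightarrow> u \<in> Z \<longleftrightarrow> v \<notin> Z" for Z
    proof (rule quasikernelI)
      show "v \<in> H \<inter> Z \<or> (\<exists>u\<in>H \<inter> Z. u \<rightarrow>\<^bsub>D\<^esub> v) \<or> (\<exists>u\<in>H \<inter> Z. \<exists>w. u \<rightarrow>\<^bsub>D\<^esub> w \<and> w \<rightarrow>\<^bsub>D\<^esub> v)"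
        if v: "v \<in> verts D" for v
      proof -
        obtain w where w: "w \<in> H" "w \<rightarrow>\<^bsub>D\<^esub> v" using dom[OF v] by auto
        obtain u where u: "u \<in> H" "u \<rightarrow>\<^bsub>D\<^esub> w" using dom[of w] w HV by auto
        show ?thesis using w u Z by blast
      qed
    qed (use HV Z in auto)
    have qX: "quasikernel D (H \<inter> X)" and qY: "quasikernel D (H \<inter> - X)"
      by (rule half, use bip in blast)+
    have "card (H \<inter> X) + card (H \<inter> - X) = card ((H \<inter> X) \<union> (H \<inter> - X))"
      using finH by (subst card_Un_disjoint) auto
    also have "(H \<inter> X) \<union> (H \<inter> - X) = H" by auto
    finally have "35 * card (H \<inter> X) \<le> 17 * n \<or> 35 * card (H \<inter> - X) \<le> 17 * n"
      using True by linarith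
    then obtain Q where "quasikernel D Q" "35 * card Q \<le> 17 * n" using qX qY by blast
    then show ?thesis by (intro exI[of _ Q]) (auto simp: field_simps)
  next
    case False
    from dom obtain f where f: "\<And>v. v \<in> verts D \<Longrightarrow> f v \<in> H" "\<And>v. v \<in> verts D \<Longrightarrow> f v \<rightarrow>\<^bsub>D\<^esub> v"
      by metis
    have C4: "(f ^^ 4) v \<noteq> v" if v: "v \<in> verts D" for v
    proof
      assume "(f ^^ 4) v = v"
      then have "f (f (f (f v))) = v" by (simp add: eval_nat_numeral)
      then have "v \<rightarrow>\<^bsub>D\<^esub> f (f (f v))" "f (f (f v)) \<rightarrow>\<^bsub>D\<^esub> f (f v)" "f (f v) \<rightarrow>\<^bsub>D\<^esub> f v" "f v \<rightarrow>\<^bsub>D\<^esub> v"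
        using f v HV by (metis subsetD)+
      then show False using closed_walk_4_imp_cycle assms(5) by blast
    qed
    obtain Q where Q: "Q \<subseteq> verts D" "\<forall>u\<in>Q. \<forall>v\<in>Q. \<not> u \<rightarrow>\<^bsub>D\<^esub> v"
        "\<forall>v\<in>verts D. v \<in> Q \<or> (\<exists>u\<in>Q. u \<rightarrow>\<^bsub>D\<^esub> v) \<or> (\<exists>u\<in>Q. \<exists>w. u \<rightarrow>\<^bsub>D\<^esub> w \<and> w \<rightarrow>\<^bsub>D\<^esub> v)"
        "7 * card Q \<le> 3 * card (verts D) + 14 * (card (verts D) - card H)"
      using sparse_quasikernel[of "verts D" H "dominates D" X f] finite_verts HV bip no_2cycles f priv C4
      by blast
    have "quasikernel D Q" using Q(1-3) by (intro quasikernelI) auto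
    moreover have "35 * card Q \<le> 17 * n" using Q(4) False cH assms(2) by simp
    then have "real (card Q) \<le> 17 / 35 * real n" by (simp add: field_simps)
    ultimately show ?thesis by blast
  qed
qed

end
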